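(* Let $0\le v_1<\cdots<v_n$ be real numbers, let $J\subset\{1,\ldots,n\}$, and let $(J_+,J_-)$ be a partition of $J$. For every $J$-circuit $\bar x(J)$ that is undominated with respect to $(J_+,J_-)$, there is an ordering $j_1,\ldots,j_m$ of the elements of $J$ for which the greedy procedure generates $\bar x(J)$.
   Context: For $J\subset\{1,\ldots,n\}$, a $J$-circuit is a tuple $x(J)=(x_j)_{j\in J}$ of pairwise distinct values from $\{v_1,\ldots,v_n\}$ that creates no cycle: there are no $k\ge 1$ and distinct $i_1,\ldots,i_k\in J$ with $x_{i_t}=v_{i_{t+1}}$ for $t=1,\ldots,k-1$ and $x_{i_k}=v_{i_1}$. For a partition $(J_+,J_-)$ of $J$ (parts may be empty), $x(J)$ dominates $y(J)$ with respect to $(J_+,J_-)$ if $x_j\le y_j$ for all $j\in J_+$ and $x_j\ge y_j$ for all $j\in J_-$. A $J$-circuit is undominated with respect to $(J_+,J_-)$ if no other $J$-circuit dominates it with respect to $(J_+,J_-)$. Greedy procedure for an ordering $j_1,\ldots,j_m$ of the elements of $J$: for $i=1,\ldots,m$ in turn, given $\bar x_{j_1},\ldots,\bar x_{j_{i-1}}$, let $\bar x_{j_i}$ be the minimum (if $j_i\in J_+$) or the maximum (if $j_i\in J_-$) among those values in $\{v_1,\ldots,v_n\}\setminus\{\bar x_{j_1},\ldots,\bar x_{j_{i-1}}\}$ for which $(\bar x_{j_1},\ldots,\bar x_{j_i})$ is a $J'$-circuit, where $J'=\{j_1,\ldots,j_i\}$. The generated tuple is $\bar x(J)=(\bar x_j)_{j\in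 J}$. *)

theory Defs
  imports Complex_Main "HOL-Library.FuncSet"
begin

definition creates_cycle :: "(nat \<Rightarrow> real) \<Rightarrow> nat set \<Rightarrow> (nat \<Rightarrow> real) \<Rightarrow> bool" where
  "creates_cycle v J x \<longleftrightarrow>
     (\<exists>is. is \<noteq> [] \<and> distinct is \<and> set is \<subseteq> J \<and>
       (\<forall>t. Suc t < length is \<longrightarrow> x (is ! t) = v (is ! Suc t)) \<and>
       x (last is) = v (hd is))"

text \<open>
  A tuple indexed by \<open>J\<close> is a function that is \<open>undefined\<close> outside \<open>J\<close>
  (extensional function space), so that equality of tuples is equality of functions.
\<close>

definition circuit :: "(nat \<Rightarrow> real) \<Rightarrow> nat \<Rightarrow> nat set \<Rightarrow> (nat \<Rightarrow> real) \<Rightarrow> bool" where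
  "circuit v n J x \<longleftrightarrow>
     x \<in> J \<rightarrow>\<^sub>E v ` {1..n} \<and> inj_on x J \<and> \<not> creates_cycle v J x"

definition dominates ::
  "nat set \<Rightarrow> nat set \<Rightarrow> (nat \<Rightarrow> real) \<Rightarrow> (nat \<Rightarrow> real) \<Rightarrow> bool" where
  "dominates Jp Jm x y \<longleftrightarrow> (\<forall>j\<in>Jp. x j \<le> y j) \<and> (\<forall>j\<in>Jm. x j \<ge> y j)"

definition undominated ::
  "(nat \<Rightarrow> real) \<Rightarrow> nat \<Rightarrow> nat set \<Rightarrow> nat set \<Rightarrow> nat set \<Rightarrow> (nat \<Rightarrow> real) \<Rightarrow> bool" where
  "undominated v n J Jp Jm x \<longleftrightarrow>
     circuit v n J x \<and> \<not> (\<exists>y. circuit v n J y \<and> y \<noteq> x \<and> dominates Jp Jm y x)"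

definition candidates ::
  "(nat \<Rightarrow> real) \<Rightarrow> nat \<Rightarrow> nat set \<Rightarrow> (nat \<Rightarrow> real) \<Rightarrow> nat \<Rightarrow> real set" where
  "candidates v n D x j =
     {a \<in> v ` {1..n} - x ` D. circuit v n (insert j D) (x(j := a))}"

text \<open>
  \<open>greedy v n Jp Jm js x\<close>: processing the indices in the order \<open>js\<close>, the greedy
  procedure can carry out every step and generates the tuple \<open>x\<close>, indexed by \<open>set js\<close>.
  As \<^term>\<open>Min {}\<close> and \<^term>\<open>Max {}\<close> are unspecified values, a step is possible only
  if some candidate value exists.
\<close>

inductive greedy ::
  "(nat \<Rightarrow> real) \<Rightarrow> nat \<Rightarrow> nat set \<Rightarrow> nat set \<Rightarrow> nat list \<Rightarrow> (nat \<Rightarrow> real) \<Rightarrow> bool"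
  for v :: "nat \<Rightarrow> real" and n :: nat and Jp Jm :: "nat set" where
  greedy_Nil: "greedy v n Jp Jm [] (\<lambda>_. undefined)"
| greedy_min: "greedy v n Jp Jm (js @ [j]) (x(j := Min (candidates v n (set js) x j)))"
    if "greedy v n Jp Jm js x" and "j \<notin> set js" and "j \<in> Jp"
      and "candidates v n (set js) x j \<noteq> {}"
| greedy_max: "greedy v n Jp Jm (js @ [j]) (x(j := Max (candidates v n (set js) x j)))"
    if "greedy v n Jp Jm js x" and "j \<notin> set js" and "j \<in> Jm"
      and "candidates v n (set js) x j \<noteq> {}"

end

theory Submission
  imports Defs
begin

text \<open>
  Write \<open>x j = v (\<sigma> j)\<close> and draw an arc from \<open>j\<close> to \<open>\<sigma> j\<close> for each \<open>j\<close> in \<open>J\<close>. The tuple is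
  a circuit exactly if \<open>\<sigma>\<close> is injective and these arcs form no directed cycle, that is, if they form
  a disjoint union of paths on \<open>{1..n}\<close>.

  The ordering is built one index at a time, from the front. Suppose that the values at a proper
  subset \<open>D\<close> of \<open>J\<close> have been chosen. It is enough to find an index \<open>j\<close> in \<open>J - D\<close> whose value in
  \<open>x\<close> is what the greedy procedure picks for \<open>j\<close> now, for then \<open>j\<close> can come next. So let no such
  index exist. The nodes not yet used as values are called free; an index \<open>j\<close> may take any free node
  except the start of the path of \<open>D\<close>-arcs that ends in \<open>j\<close>. As the procedure is stuck, the least free
  node \<open>a\<close> is not the value of an undetermined index of \<open>J\<^sub>+\<close>, and if the \<open>D\<close>-path from \<open>a\<close>
  ends in \<open>f\<close> in \<open>J\<^sub>+\<close>, then even the second least free node lies below \<open>\<sigma> f\<close>. The mirror images of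
  these facts hold for the greatest free node \<open>c\<close> and \<open>J\<^sub>-\<close>.

  In every such situation some rearrangement of a few arcs gives a circuit that dominates \<open>x\<close>.
  The rearrangements cut a path into consecutive blocks and put the blocks together in another order
  (\<open>no_rotation\<close>, \<open>no_reversal\<close>, \<open>no_block_swap\<close>), exchange the ends of two paths (\<open>no_swap\<close>), or
  move one arc to an unused node (\<open>no_reassignment\<close>).
  Which one applies depends on whether \<open>a\<close> and \<open>c\<close> are values of \<open>\<sigma>\<close>: both
  (\<open>not_both_extremes_used\<close>), neither (\<open>not_both_extremes_unused\<close>), or one of them
  (\<open>least_unused_greatest_used\<close>). Replacing \<open>v\<close> by \<open>- v\<close> and exchanging \<open>J\<^sub>+\<close> with \<open>J\<^sub>-\<close> settles the
  symmetric cases.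
\<close>

section \<open>Linear forests\<close>

definition arcs :: "('a \<Rightarrow> 'a) \<Rightarrow> 'a set \<Rightarrow> ('a \<times> 'a) set" where
  "arcs \<sigma> J = {(j, \<sigma> j) | j. j \<in> J}"

definition linear_forest :: "'a set \<Rightarrow> 'a set \<Rightarrow> ('a \<Rightarrow> 'a) \<Rightarrow> bool" where
  "linear_forest N J \<sigma> \<longleftrightarrow> \<sigma> ` J \<subseteq> N \<and> inj_on \<sigma> J \<and> acyclic (arcs \<sigma> J)"

lemma in_arcs_iff: "(u, w) \<in> arcs \<sigma> J \<longleftrightarrow> u \<in> J \<and> w = \<sigma> u"
  by (auto simp: arcs_def)

lemma arcs_mono: "D \<subseteq> J \<Longrightarrow> arcs \<sigma> D \<subseteq> arcs \<sigma> J"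
  by (auto simp: arcs_def)

text \<open>
  A new arc is harmless if it leads to a strictly later block: a closed walk never leaves its block
  and therefore consists of old arcs. All rearrangements below are shown to be acyclic in this way.
\<close>
lemma acyclic_block_order:
  fixes \<beta> :: "'a \<Rightarrow> nat"
  assumes "acyclic (arcs \<sigma> J)"
    and blocks: "\<And>j. j \<in> J \<Longrightarrow> \<beta> j < \<beta> (\<tau> j) \<or> (\<beta> j = \<beta> (\<tau> j) \<and> \<tau> j = \<sigma> j)"
  shows "acyclic (arcs \<tau> J)"
proof -
  have "\<beta> u < \<beta> w \<or> (\<beta> u = \<beta> w \<and> (u, w) \<in> (arcs \<sigma> J)\<^sup>+)" if "(u, w) \<in> (arcs \<tau> J)\<^sup>+" for u w
    using that
  proof (induction rule: trancl_induct)
    case (base y)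
    then show ?case using blocks[of u] by (auto simp: in_arcs_iff)
  next
    case (step y z)
    then have y: "y \<in> J" "z = \<tau> y" by (auto simp: in_arcs_iff)
    from blocks[OF y(1)] show ?case
    proof
      assume "\<beta> y = \<beta> (\<tau> y) \<and> \<tau> y = \<sigma> y"
      then have "(y, z) \<in> arcs \<sigma> J" "\<beta> y = \<beta> z" using y by (auto simp: in_arcs_iff)
      then show ?thesis using step.IH by (auto intro: trancl_into_trancl)
    qed (use step.IH y in auto)
  qed
  then show ?thesis using assms(1) unfolding acyclic_def by blast
qed

section \<open>Rearrangements that an undominated forest excludes\<close>
locale undominated_forest =
  fixes N J Jp Jm :: "'a set" and v :: "'a \<Rightarrow> real" and \<sigma> :: "'a \<Rightarrow> 'a"
  assumes finite_N: "finite N" and J_sub: "J \<subseteq> N"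
    and parts: "Jp \<union> Jm = J" "Jp \<inter> Jm = {}"
    and inj_v: "inj_on v N"
    and forest: "linear_forest N J \<sigma>"
    and undom: "\<And>\<tau>. linear_forest N J \<tau> \<Longrightarrow> \<forall>j\<in>Jp. v (\<tau> j) \<le> v (\<sigma> j) \<Longrightarrow>
      \<forall>j\<in>Jm. v (\<sigma> j) \<le> v (\<tau> j) \<Longrightarrow> \<forall>j\<in>J. \<tau> j = \<sigma> j"
begin

abbreviation reach :: "'a \<Rightarrow> 'a \<Rightarrow> bool" where
  "reach u w \<equiv> (u, w) \<in> (arcs \<sigma> J)\<^sup>*"

definition improves :: "'a \<Rightarrow> 'a \<Rightarrow> 'a \<Rightarrow> bool" where
  "improves j u w \<longleftrightarrow> (j \<in> Jp \<and> v u < v w) \<or> (j \<in> Jm \<and> v w < v u)"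

lemma inj_\<sigma>: "i \<in> J \<Longrightarrow> j \<in> J \<Longrightarrow> \<sigma> i = \<sigma> j \<longleftrightarrow> i = j"
  using forest by (auto simp: linear_forest_def inj_on_def)

lemma \<sigma>_in: "j \<in> J \<Longrightarrow> \<sigma> j \<in> N"
  using forest by (auto simp: linear_forest_def)

lemma acyclic_\<sigma>: "acyclic (arcs \<sigma> J)"
  using forest by (auto simp: linear_forest_def)

lemma reach_iff: "u \<in> J \<Longrightarrow> reach u w \<longleftrightarrow> u = w \<or> reach (\<sigma> u) w"
  by (metis converse_rtranclE converse_rtrancl_into_rtrancl in_arcs_iff rtrancl.rtrancl_refl)

lemma no_return: "j \<in> J \<Longrightarrow> \<not> reach (\<sigma> j) j"
  using acyclic_\<sigma> unfolding acyclic_def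
  by (meson in_arcs_iff rtrancl_into_trancl2)

lemma reach_antisym: "reach u w \<Longrightarrow> reach w u \<Longrightarrow> u = w"
  using acyclic_\<sigma> by (metis acyclic_impl_antisym_rtrancl antisymD)

lemma reach_start: "w \<notin> \<sigma> ` J \<Longrightarrow> reach u w \<Longrightarrow> u = w"
  by (metis imageI in_arcs_iff rtranclE)

text \<open>
  Nodes outside \<open>\<sigma> ` J\<close> are the starts of the paths. The predecessors of a node form a chain, because
  \<open>\<sigma>\<close> is injective, and a start is the first node of this chain.
\<close>
lemma start_reaches:
  assumes "s \<notin> \<sigma> ` J" "reach u w" "reach s w"
  shows "reach s u"
  using assms(2,3)
proof (induction rule: rtrancl_induct)
  case (step y z)
  then have y: "y \<in> J" "z = \<sigma> y" by (auto simp: in_arcs_iff)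
  with assms(1) have "s \<noteq> z" by auto
  with step.prems obtain y' where "reach s y'" "(y', z) \<in> arcs \<sigma> J" by (metis rtranclE)
  then show ?case using y step.IH inj_\<sigma> by (metis in_arcs_iff)
qed

lemma start_unique: "s \<notin> \<sigma> ` J \<Longrightarrow> t \<notin> \<sigma> ` J \<Longrightarrow> reach s w \<Longrightarrow> reach t w \<Longrightarrow> s = t"
  using start_reaches reach_start by blast

lemma start_exists:
  assumes "j \<in> N"
  shows "\<exists>s\<in>N. s \<notin> \<sigma> ` J \<and> reach s j"
proof -
  have "finite (arcs \<sigma> J)"
    using finite_subset[OF J_sub finite_N] by (auto simp: arcs_def)
  then have "wf (arcs \<sigma> J)" using acyclic_\<sigma> by (rule finite_acyclic_wf)
  then show ?thesis using assms
  proof (induction j rule: wf_induct_rule)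
    case (less j)
    show ?case
    proof (cases "j \<in> \<sigma> ` J")
      case True
      then obtain i where i: "i \<in> J" "j = \<sigma> i" by auto
      then have "(i, j) \<in> arcs \<sigma> J" by (simp add: in_arcs_iff)
      with less.IH[of i] i(1) J_sub show ?thesis by (meson rtrancl.rtrancl_into_rtrancl subsetD)
    qed (use less.prems in auto)
  qed
qed

text \<open>
  The common frame of the rearrangements: the arcs of the indices in \<open>S\<close> are moved, each to a better
  value, and the block function \<open>\<beta>\<close> witnesses acyclicity.
\<close>
lemma no_improvement:
  fixes \<beta> :: "'a \<Rightarrow> nat"
  assumes "S \<subseteq> J" "S \<noteq> {}" "\<And>j. j \<in> S \<Longrightarrow> improves j (\<tau> j) (\<sigma> j)"
    and "\<And>j. j \<notin> S \<Longrightarrow> \<tau> j = \<sigma> j"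
    and "\<tau> ` S \<subseteq> N" "inj_on \<tau> J"
    and "\<And>j. j \<in> J \<Longrightarrow> \<beta> j < \<beta> (\<tau> j) \<or> (\<beta> j = \<beta> (\<tau> j) \<and> \<tau> j = \<sigma> j)"
  shows False
proof -
  have "acyclic (arcs \<tau> J)" using acyclic_\<sigma> assms(7) by (rule acyclic_block_order)
  moreover have "\<tau> ` J \<subseteq> N" using assms(4,5) \<sigma>_in by (metis image_subset_iff)
  ultimately have lf: "linear_forest N J \<tau>" using assms(6) by (simp add: linear_forest_def)
  have w: "j \<in> Jp \<longrightarrow> v (\<tau> j) \<le> v (\<sigma> j)" "j \<in> Jm \<longrightarrow> v (\<sigma> j) \<le> v (\<tau> j)" for j
    using assms(3)[of j] assms(4)[of j] parts(2) unfolding improves_def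
    by (cases "j \<in> S"; force)+
  have "\<forall>j\<in>J. \<tau> j = \<sigma> j" using undom[OF lf] w by blast
  then show False using assms(1-3) unfolding improves_def by fastforce
qed

text \<open>
  Moving the arc of \<open>j\<close> to an unused node \<open>u\<close> closes a cycle only if \<open>u\<close> leads to \<open>j\<close>. Here and
  below, the blocks are made from sets of the form \<open>{t. reach t j}\<close>: no arc enters such a set, and
  the only arc that leaves it is the one of \<open>j\<close>.
\<close>
lemma no_reassignment:
  assumes "j \<in> J" "u \<in> N" "u \<notin> \<sigma> ` J" "improves j u (\<sigma> j)"
  shows "reach u j"
proof (rule ccontr)
  assume nr: "\<not> reach u j"
  define \<tau> where "\<tau> = \<sigma>(j := u)"
  define \<beta> :: "'a \<Rightarrow> nat" where "\<beta> t = (if reach t j then 0 else 1)" for t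
  show False
  proof (rule no_improvement[of "{j}" \<tau> \<beta>])
    show "inj_on \<tau> J" using assms(3) inj_\<sigma> by (auto simp: \<tau>_def inj_on_def)
    fix t assume "t \<in> J"
    then show "\<beta> t < \<beta> (\<tau> t) \<or> (\<beta> t = \<beta> (\<tau> t) \<and> \<tau> t = \<sigma> t)"
      using nr reach_iff[of t j] by (auto simp: \<tau>_def \<beta>_def)
  qed (use assms in \<open>auto simp: \<tau>_def\<close>)
qed

text \<open>Indices on different paths can exchange their values, together with the remainders of their paths.\<close>
lemma no_swap:
  assumes "i \<in> J" "k \<in> J" "improves i (\<sigma> k) (\<sigma> i)" "improves k (\<sigma> i) (\<sigma> k)"
  shows "reach i k \<or> reach k i"
proof (rule ccontr)
  assume nr: "\<not> (reach i k \<or> reach k i)"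
  then have "i \<noteq> k" by auto
  define \<tau> where "\<tau> = \<sigma>(i := \<sigma> k, k := \<sigma> i)"
  define \<beta> :: "'a \<Rightarrow> nat" where "\<beta> t = (if reach t i \<or> reach t k then 0 else 1)" for t
  show False
  proof (rule no_improvement[of "{i, k}" \<tau> \<beta>])
    show "inj_on \<tau> J" using inj_\<sigma> assms \<open>i \<noteq> k\<close> by (auto simp: \<tau>_def inj_on_def)
    fix t assume "t \<in> J"
    then show "\<beta> t < \<beta> (\<tau> t) \<or> (\<beta> t = \<beta> (\<tau> t) \<and> \<tau> t = \<sigma> t)"
      using nr reach_iff[of t i] reach_iff[of t k] no_return[of i] no_return[of k]
        reach_iff[of i k] reach_iff[of k i] assms(1,2)
      by (auto simp: \<tau>_def \<beta>_def)
  qed (use assms \<sigma>_in \<open>i \<noteq> k\<close> in \<open>auto simp: \<tau>_def\<close>)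
qed

text \<open>
  With \<open>A\<close> the path from \<open>s\<close> to \<open>i\<close>, \<open>B\<close> the path from \<open>\<sigma> i\<close> to \<open>k\<close> and \<open>C\<close> the remainder, the path
  \<open>A B C\<close> becomes \<open>B A C\<close>.
\<close>
lemma no_rotation:
  assumes "i \<in> J" "k \<in> J" "i \<noteq> k" "reach i k" "s \<in> N" "s \<notin> \<sigma> ` J" "reach s i"
    and "improves i (\<sigma> k) (\<sigma> i)" "improves k s (\<sigma> k)"
  shows False
proof -
  define \<tau> where "\<tau> = \<sigma>(i := \<sigma> k, k := s)"
  define \<beta> :: "'a \<Rightarrow> nat" where
    "\<beta> t = (if reach t i then 1 else if reach t k then 0 else 2)" for t
  have trans: "reach t i \<Longrightarrow> reach t k" for t using assms(4) by (meson rtrancl_trans)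
  have "\<not> reach k i" using reach_antisym assms(3,4) by blast
  show False
  proof (rule no_improvement[of "{i, k}" \<tau> \<beta>])
    show "inj_on \<tau> J" using inj_\<sigma> assms by (auto simp: \<tau>_def inj_on_def)
    fix t assume "t \<in> J"
    then show "\<beta> t < \<beta> (\<tau> t) \<or> (\<beta> t = \<beta> (\<tau> t) \<and> \<tau> t = \<sigma> t)"
      using trans[of t] trans[of "\<sigma> t"] trans[of "\<sigma> k"] \<open>\<not> reach k i\<close> reach_iff[of t i] reach_iff[of t k]
        no_return[of i] no_return[of k] assms
      by (auto simp: \<tau>_def \<beta>_def)
  qed (use assms \<sigma>_in in \<open>auto simp: \<tau>_def\<close>)
qed

text \<open>
  The path \<open>A B C R\<close> with the cuts after \<open>i\<close>, \<open>m\<close> and \<open>k\<close> becomes \<open>C B A R\<close>.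
\<close>
lemma no_reversal:
  assumes "i \<in> J" "m \<in> J" "k \<in> J" "i \<noteq> m" "m \<noteq> k" "reach i m" "reach m k"
    and "s \<in> N" "s \<notin> \<sigma> ` J" "reach s i"
    and "improves i (\<sigma> k) (\<sigma> i)" "improves m s (\<sigma> m)" "improves k (\<sigma> i) (\<sigma> k)"
  shows False
proof -
  define \<tau> where "\<tau> = \<sigma>(i := \<sigma> k, m := s, k := \<sigma> i)"
  define \<beta> :: "'a \<Rightarrow> nat" where
    "\<beta> t = (if reach t i then 2 else if reach t m then 1 else if reach t k then 0 else 3)" for t
  have trans: "reach t i \<Longrightarrow> reach t m" "reach t m \<Longrightarrow> reach t k" for t
    using assms(6,7) by (meson rtrancl_trans)+
  have nr: "\<not> reach m i" "\<not> reach k m" using reach_antisym assms(4-7) by blast+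
  then have "i \<noteq> k" using assms(6) by auto
  have "reach (\<sigma> i) m" using assms(1,4,6) reach_iff by blast
  show False
  proof (rule no_improvement[of "{i, m, k}" \<tau> \<beta>])
    show "inj_on \<tau> J" using inj_\<sigma> assms \<open>i \<noteq> k\<close> by (auto simp: \<tau>_def inj_on_def)
    fix t assume "t \<in> J"
    then show "\<beta> t < \<beta> (\<tau> t) \<or> (\<beta> t = \<beta> (\<tau> t) \<and> \<tau> t = \<sigma> t)"
      using trans[of t] trans[of "\<sigma> t"] trans[of "\<sigma> k"] trans[of k] nr \<open>reach (\<sigma> i) m\<close>
        reach_iff[of t i] reach_iff[of t m] reach_iff[of t k]
        no_return[of i] no_return[of m] no_return[of k] assms \<open>i \<noteq> k\<close>
      by (auto simp: \<tau>_def \<beta>_def)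
  qed (use assms \<sigma>_in \<open>i \<noteq> k\<close> in \<open>auto simp: \<tau>_def\<close>)
qed

text \<open>
  The path \<open>A B C R\<close> with the cuts after \<open>i\<close>, \<open>m\<close> and \<open>k\<close> becomes \<open>A C B R\<close>; the start of the path
  does not change.
\<close>
lemma no_block_swap:
  assumes "i \<in> J" "m \<in> J" "k \<in> J" "i \<noteq> m" "m \<noteq> k" "reach i m" "reach m k"
    and "improves i (\<sigma> m) (\<sigma> i)" "improves m (\<sigma> k) (\<sigma> m)" "improves k (\<sigma> i) (\<sigma> k)"
  shows False
proof -
  define \<tau> where "\<tau> = \<sigma>(i := \<sigma> m, m := \<sigma> k, k := \<sigma> i)"
  define \<beta> :: "'a \<Rightarrow> nat" where
    "\<beta> t = (if reach t i then 0 else if reach t m then 2 else if reach t k then 1 else 3)" for t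
  have trans: "reach t i \<Longrightarrow> reach t m" "reach t m \<Longrightarrow> reach t k" for t
    using assms(6,7) by (meson rtrancl_trans)+
  have nr: "\<not> reach m i" "\<not> reach k m" using reach_antisym assms(4-7) by blast+
  then have "i \<noteq> k" using assms(6) by auto
  have st: "reach (\<sigma> i) m" "reach (\<sigma> m) k" using assms(1,2,4-7) reach_iff by blast+
  show False
  proof (rule no_improvement[of "{i, m, k}" \<tau> \<beta>])
    show "inj_on \<tau> J" using inj_\<sigma> assms \<open>i \<noteq> k\<close> by (auto simp: \<tau>_def inj_on_def)
    fix t assume "t \<in> J"
    then show "\<beta> t < \<beta> (\<tau> t) \<or> (\<beta> t = \<beta> (\<tau> t) \<and> \<tau> t = \<sigma> t)"
      using trans[of t] trans[of "\<sigma> t"] trans[of "\<sigma> k"] trans[of "\<sigma> m"] trans[of k] nr st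
        reach_iff[of t i] reach_iff[of t m] reach_iff[of t k]
        no_return[of i] no_return[of m] no_return[of k] assms \<open>i \<noteq> k\<close>
      by (auto simp: \<tau>_def \<beta>_def)
  qed (use assms \<sigma>_in \<open>i \<noteq> k\<close> in \<open>auto simp: \<tau>_def\<close>)
qed

end

section \<open>A stuck greedy procedure\<close>

text \<open>
  The indices in \<open>D\<close> have their values, and for each of the others the greedy procedure would now pick
  a better value than \<open>\<sigma>\<close> does. A value \<open>w\<close> is ruled out for \<open>j\<close> if it is taken or if arcs of \<open>D\<close>
  already lead from \<open>w\<close> to \<open>j\<close>.
\<close>
locale greedy_stuck = undominated_forest +
  fixes D :: "'a set"
  assumes D_sub: "D \<subset> J"
    and stuck_min: "\<And>j. j \<in> Jp - D \<Longrightarrow>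
      \<exists>w\<in>N - \<sigma> ` D. (w, j) \<notin> (arcs \<sigma> D)\<^sup>* \<and> v w < v (\<sigma> j)"
    and stuck_max: "\<And>j. j \<in> Jm - D \<Longrightarrow>
      \<exists>w\<in>N - \<sigma> ` D. (w, j) \<notin> (arcs \<sigma> D)\<^sup>* \<and> v (\<sigma> j) < v w"
begin

abbreviation free_values :: "'a set" where "free_values \<equiv> N - \<sigma> ` D"

text \<open>By this symmetry one case of each mirror pair is enough.\<close>
lemma flipped: "greedy_stuck N J Jm Jp (\<lambda>u. - v u) \<sigma> D"
proof unfold_locales
  show "inj_on (\<lambda>u. - v u) N" using inj_v by (simp add: inj_on_def)
  show "\<And>\<tau>. linear_forest N J \<tau> \<Longrightarrow> \<forall>j\<in>Jm. - v (\<tau> j) \<le> - v (\<sigma> j) \<Longrightarrow>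
      \<forall>j\<in>Jp. - v (\<sigma> j) \<le> - v (\<tau> j) \<Longrightarrow> \<forall>j\<in>J. \<tau> j = \<sigma> j"
    using undom by auto
qed (use finite_N J_sub parts forest D_sub stuck_min stuck_max in auto)

lemma v_eq: "u \<in> N \<Longrightarrow> w \<in> N \<Longrightarrow> v u = v w \<longleftrightarrow> u = w"
  using inj_v by (auto simp: inj_on_def)

lemma \<sigma>_free: "j \<in> J - D \<Longrightarrow> \<sigma> j \<in> free_values"
  using \<sigma>_in inj_\<sigma> D_sub by blast

lemma free_used: "w \<in> free_values \<Longrightarrow> w \<in> \<sigma> ` J \<Longrightarrow> \<exists>j\<in>J - D. \<sigma> j = w"
  by blast

lemma reach_D: "(u, w) \<in> (arcs \<sigma> D)\<^sup>* \<Longrightarrow> reach u w"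
  using D_sub rtrancl_mono[OF arcs_mono[of D J \<sigma>]] by blast

text \<open>
  Following the path of \<open>\<sigma>\<close> from a free node \<open>u\<close>, the first undetermined index \<open>f\<close> is the only one for
  which \<open>u\<close> closes a cycle at this stage. It precedes all other undetermined indices on the path.
\<close>
lemma first_undetermined:
  assumes "reach u j" "j \<in> J - D"
  shows "\<exists>f\<in>J - D. (u, f) \<in> (arcs \<sigma> D)\<^sup>*"
  using assms(1)
proof (induction rule: converse_rtrancl_induct)
  case base
  then show ?case using assms(2) by blast
next
  case (step u w)
  show ?case
  proof (cases "u \<in> D")
    case True
    with step.hyps have "(u, w) \<in> arcs \<sigma> D" by (simp add: in_arcs_iff)
    with step.IH show ?thesis by (meson converse_rtrancl_into_rtrancl)
  next
    case False
    with step.hyps show ?thesis by (auto simp: in_arcs_iff)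
  qed
qed

lemma first_undetermined_reaches:
  assumes "(u, f) \<in> (arcs \<sigma> D)\<^sup>*" "reach u j" "j \<in> J - D"
  shows "reach f j"
  using assms(1,2)
proof (induction rule: converse_rtrancl_induct)
  case (step u w)
  then have "u \<in> D" "w = \<sigma> u" by (auto simp: in_arcs_iff)
  with step.prems step.IH reach_iff assms(3) D_sub show ?case by (metis DiffD2 psubsetD)
qed

lemma exists_least_value:
  assumes "A \<subseteq> N" "A \<noteq> {}"
  shows "\<exists>a\<in>A. \<forall>w\<in>A. v a \<le> v w"
proof -
  have "finite (v ` A)" using finite_subset[OF assms(1) finite_N] by simp
  then have "Min (v ` A) \<in> v ` A" "\<forall>w\<in>A. Min (v ` A) \<le> v w" using assms(2) by auto
  then show ?thesis by force
qed

definition least_free :: "'a \<Rightarrow> bool" where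
  "least_free a \<longleftrightarrow> a \<in> free_values \<and> (\<forall>w\<in>free_values. v a \<le> v w)"

definition greatest_free :: "'a \<Rightarrow> bool" where
  "greatest_free c \<longleftrightarrow> c \<in> free_values \<and> (\<forall>w\<in>free_values. v w \<le> v c)"

lemma least_free_less: "least_free a \<Longrightarrow> w \<in> free_values \<Longrightarrow> w \<noteq> a \<Longrightarrow> v a < v w"
  unfolding least_free_def using v_eq[of a w] by (metis DiffD1 order_le_less)

lemma greatest_free_greater: "greatest_free c \<Longrightarrow> w \<in> free_values \<Longrightarrow> w \<noteq> c \<Longrightarrow> v w < v c"
  unfolding greatest_free_def using v_eq[of c w] by (metis DiffD1 order_le_less)

text \<open>
  A minimizing index with value \<open>a\<close> would be a greedy choice, as there is no better free value.
\<close>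
lemma least_free_used_by_max:
  assumes "least_free a" "a \<in> \<sigma> ` J"
  shows "\<exists>j\<in>Jm - D. \<sigma> j = a"
proof -
  obtain j where j: "j \<in> J - D" "\<sigma> j = a"
    using free_used assms by (auto simp: least_free_def)
  then have "j \<notin> Jp"
    using stuck_min[of j] assms(1) by (auto simp: least_free_def not_le[symmetric])
  then show ?thesis using j parts by blast
qed

lemma greatest_free_used_by_min:
  assumes "greatest_free c" "c \<in> \<sigma> ` J"
  shows "\<exists>k\<in>Jp - D. \<sigma> k = c"
proof -
  obtain k where k: "k \<in> J - D" "\<sigma> k = c"
    using free_used assms by (auto simp: greatest_free_def)
  then have "k \<notin> Jm"
    using stuck_max[of k] assms(1) by (auto simp: greatest_free_def not_le[symmetric])
  then show ?thesis using k parts by blast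
qed

lemma start_reaches_min:
  assumes "u \<in> N" "u \<notin> \<sigma> ` J" "j \<in> Jp - D" "v u < v (\<sigma> j)"
  shows "reach u j"
  using no_reassignment[of j u] assms parts by (auto simp: improves_def)

lemma start_reaches_max:
  assumes "u \<in> N" "u \<notin> \<sigma> ` J" "j \<in> Jm - D" "v (\<sigma> j) < v u"
  shows "reach u j"
  using no_reassignment[of j u] assms parts by (auto simp: improves_def)

lemma comparable:
  assumes "i \<in> Jp - D" "k \<in> Jm - D" "v (\<sigma> k) < v (\<sigma> i)"
  shows "reach i k \<or> reach k i"
  using no_swap[of i k] assms parts by (auto simp: improves_def)

text \<open>
  Since \<open>a\<close> itself would close a cycle at \<open>f\<close>, the better value that is available to \<open>f\<close> is another one.
\<close>
lemma second_least_below: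
  assumes a: "least_free a" and f: "(a, f) \<in> (arcs \<sigma> D)\<^sup>*" "f \<in> Jp - D"
  shows "\<exists>b\<in>free_values. v a < v b \<and> v b < v (\<sigma> f)"
proof -
  obtain w where "w \<in> free_values" "(w, f) \<notin> (arcs \<sigma> D)\<^sup>*" "v w < v (\<sigma> f)"
    using stuck_min[OF f(2)] by blast
  then show ?thesis using least_free_less[OF a] f(1) by blast
qed

lemma second_greatest_above:
  assumes c: "greatest_free c" and f: "(c, f) \<in> (arcs \<sigma> D)\<^sup>*" "f \<in> Jm - D"
  shows "\<exists>d\<in>free_values. v d < v c \<and> v (\<sigma> f) < v d"
proof -
  obtain w where "w \<in> free_values" "(w, f) \<notin> (arcs \<sigma> D)\<^sup>*" "v (\<sigma> f) < v w"
    using stuck_max[OF f(2)] by blast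
  then show ?thesis using greatest_free_greater[OF c] f(1) by blast
qed

text \<open>
  The least free value belongs to a maximizing index \<open>j\<close> and the greatest to a minimizing index \<open>k\<close>.
  On different paths they could exchange values. On a common path, a rotation gives the
  later of the two the start of the path, which lies strictly between the extremes.
\<close>
lemma not_both_extremes_used:
  assumes a: "least_free a" "a \<in> \<sigma> ` J" and c: "greatest_free c" "c \<in> \<sigma> ` J"
  shows False
proof -
  obtain j where j: "j \<in> Jm - D" "\<sigma> j = a" using least_free_used_by_max[OF a] by blast
  obtain k where k: "k \<in> Jp - D" "\<sigma> k = c" using greatest_free_used_by_min[OF c] by blast
  have jk: "j \<in> J" "k \<in> J" "j \<noteq> k" using j k parts by auto
  with j(2) k(2) inj_\<sigma> have "a \<noteq> c" by metis
  have lt: "v a < v c"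
    using least_free_less[OF a(1)] c(1) \<open>a \<noteq> c\<close> by (auto simp: greatest_free_def)
  have start: "\<exists>s\<in>N. s \<notin> \<sigma> ` J \<and> reach s t \<and> v a < v s \<and> v s < v c" if "t \<in> J" for t
  proof -
    obtain s where s: "s \<in> N" "s \<notin> \<sigma> ` J" "reach s t" using start_exists \<open>t \<in> J\<close> J_sub by blast
    then have "s \<in> free_values" "s \<noteq> a" "s \<noteq> c" using D_sub a(2) c(2) by auto
    then show ?thesis
      using s least_free_less[OF a(1)] greatest_free_greater[OF c(1)] by blast
  qed
  from comparable[OF k(1) j(1)] j(2) k(2) lt consider "reach k j" | "reach j k" by auto
  then show False
  proof cases
    case 1
    obtain s where "s \<in> N" "s \<notin> \<sigma> ` J" "reach s k" "v a < v s" using start[OF jk(2)] by blast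
    then show False using no_rotation[of k j s] 1 jk j k lt by (auto simp: improves_def)
  next
    case 2
    obtain s where "s \<in> N" "s \<notin> \<sigma> ` J" "reach s j" "v s < v c" using start[OF jk(1)] by blast
    then show False using no_rotation[of j k s] 2 jk j k lt by (auto simp: improves_def)
  qed
qed

text \<open>
  Suppose that some minimizing index is undetermined. All of these lie on the path that starts in
  \<open>a\<close>, for otherwise they could take the value \<open>a\<close>; likewise all undetermined maximizing indices lie on
  the path that starts in \<open>c\<close>, which is a different one. So the first undetermined index \<open>f\<close> on the path of \<open>a\<close> is minimizing, and there is a free value \<open>b\<close>
  with \<open>v a < v b < v (\<sigma> f)\<close>. If \<open>b\<close> is unused, \<open>f\<close> can take it. If a maximizing \<open>j\<close> has it, \<open>f\<close>
  and \<open>j\<close> can exchange values. If a minimizing \<open>j\<close> has it, a rotation gives \<open>b\<close> to \<open>f\<close> and \<open>a\<close> to \<open>j\<close>.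
\<close>
lemma not_both_extremes_unused:
  assumes a: "least_free a" "a \<notin> \<sigma> ` J" and c: "greatest_free c" "c \<notin> \<sigma> ` J"
  shows "Jp \<subseteq> D"
proof (rule ccontr)
  assume "\<not> Jp \<subseteq> D"
  then obtain j0 where j0: "j0 \<in> Jp - D" by blast
  have free: "\<sigma> j \<in> free_values" "\<sigma> j \<noteq> a" "\<sigma> j \<noteq> c" if "j \<in> J - D" for j
    using \<sigma>_free[OF that] that a(2) c(2) by auto
  have aN: "a \<in> N" and cN: "c \<in> N" using a c by (auto simp: least_free_def greatest_free_def)
  have from_a: "reach a j" if "j \<in> Jp - D" for j
    using start_reaches_min[OF aN a(2) that] least_free_less[OF a(1)] free[of j] that parts by blast
  have from_c: "reach c j" if "j \<in> Jm - D" for j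
    using start_reaches_max[OF cN c(2) that] greatest_free_greater[OF c(1)] free[of j] that parts
    by blast
  have "v a < v c"
    using least_free_less[OF a(1)] greatest_free_greater[OF c(1)] free[of j0] j0 parts
    by (metis DiffD1 DiffD2 DiffI UnI1 less_trans)
  then have "a \<noteq> c" by auto
  obtain f where f: "f \<in> J - D" "(a, f) \<in> (arcs \<sigma> D)\<^sup>*"
    using first_undetermined[OF from_a[OF j0]] j0 parts by blast
  have af: "reach a f" using reach_D f(2) by blast
  have fp: "f \<in> Jp - D" using f(1) parts from_c[of f] af start_unique a(2) c(2) \<open>a \<noteq> c\<close> by blast
  obtain b where b: "b \<in> free_values" "v a < v b" "v b < v (\<sigma> f)"
    using second_least_below[OF a(1) f(2) fp] by blast
  have "b \<in> \<sigma> ` J"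
    using start_reaches_min[of b f] b fp start_unique[of a b f] a(2) af by auto
  then obtain j where j: "j \<in> J - D" "\<sigma> j = b" using free_used b(1) by blast
  have "j \<noteq> f" using j b by auto
  show False
  proof (cases "j \<in> Jp")
    case True
    then have "reach f j" using first_undetermined_reaches[OF f(2)] from_a j by blast
    then show False using no_rotation[of f j a] \<open>j \<noteq> f\<close> f j aN a(2) af b True fp
      by (auto simp: improves_def)
  next
    case False
    then have jm: "j \<in> Jm - D" using j parts by blast
    have cj: "reach c j" using from_c jm by blast
    have "reach f j \<or> reach j f" using comparable[OF fp jm] j b by simp
    then show False
      using af cj start_unique[OF a(2) c(2)] \<open>a \<noteq> c\<close> by (meson rtrancl_trans)
  qed
qed

text \<open>
  Let \<open>k\<close>, necessarily minimizing, have the value \<open>c\<close>. All undetermined indices lie on the path that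
  starts in \<open>a\<close>: minimizing ones could otherwise take \<open>a\<close>, maximizing ones could otherwise exchange
  values with \<open>k\<close>. Every free value other than \<open>a\<close> is used, because \<open>k\<close> could take it otherwise.
  No maximizing index \<open>i\<close> precedes \<open>k\<close>, because a rotation would give \<open>c\<close> to \<open>i\<close> and \<open>a\<close> to \<open>k\<close>.
  Hence the first undetermined index \<open>f\<close> is minimizing, and some index \<open>j\<close> has a free value
  \<open>b\<close> with \<open>v a < v b < v (\<sigma> f)\<close>.

  If \<open>j\<close> is minimizing, a rotation gives \<open>b\<close> to \<open>f\<close> and \<open>a\<close> to \<open>j\<close>. So let \<open>j\<close> be maximizing, hence
  after \<open>k\<close>. If \<open>f\<close> and \<open>k\<close> differ, reversing three blocks gives \<open>b\<close> to \<open>f\<close>, \<open>a\<close> to \<open>k\<close> and \<open>\<sigma> f\<close>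
  to \<open>j\<close>. If \<open>f = k\<close>, the path runs from \<open>a\<close> through \<open>f\<close> directly to \<open>c\<close>, and the first undetermined
  index \<open>g\<close> after \<open>c\<close> decides.
\<close>
lemma least_unused_greatest_used:
  assumes a: "least_free a" "a \<notin> \<sigma> ` J" and c: "greatest_free c" "c \<in> \<sigma> ` J"
  shows False
proof -
  obtain k where k: "k \<in> Jp - D" "\<sigma> k = c" using greatest_free_used_by_min[OF c] by blast
  have kJ: "k \<in> J - D" using k parts by auto
  have aN: "a \<in> N" using a by (auto simp: least_free_def)
  have above: "v a < v (\<sigma> j)" if "j \<in> J - D" for j
    using least_free_less[OF a(1) \<sigma>_free[OF that]] that a(2) by blast
  have below: "v (\<sigma> j) < v c" if "j \<in> J - D" "j \<noteq> k" for j
    using greatest_free_greater[OF c(1) \<sigma>_free[OF that(1)]] that k(2) kJ inj_\<sigma>[of j k] by (metis DiffD1)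
  have min_from_a: "reach a j" if "j \<in> Jp - D" for j
    using start_reaches_min[OF aN a(2) that] above[of j] that parts by blast
  have max_comparable: "reach k i \<or> reach i k" if "i \<in> Jm - D" for i
    using comparable[OF k(1) that] below[of i] k that parts by blast
  have from_a: "reach a j" if "j \<in> J - D" for j
  proof (cases "j \<in> Jp")
    case True
    then show ?thesis using min_from_a that by blast
  next
    case False
    then have "j \<in> Jm - D" using that parts by blast
    then show ?thesis
      using max_comparable min_from_a[OF k(1)] start_reaches[OF a(2)] by (meson rtrancl_trans)
  qed
  have used: "\<exists>j\<in>J - D. \<sigma> j = u" if "u \<in> free_values" "u \<noteq> a" for u
  proof (rule ccontr)
    assume "\<not> ?thesis"
    then have u: "u \<notin> \<sigma> ` J" using free_used that(1) by blast
    then have "v u < v c" using greatest_free_greater[OF c(1) that(1)] c(2) by blast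
    then have "reach u k" using start_reaches_min[of u k] u k that(1) by auto
    then show False using start_unique[OF u a(2)] from_a[OF kJ] that(2) by blast
  qed
  have max_after_k: "reach k i" if "i \<in> Jm - D" for i
  proof (rule ccontr)
    assume "\<not> reach k i"
    then have "reach i k" "i \<noteq> k" using max_comparable[OF that] by auto
    then show False
      using no_rotation[of i k a] that k kJ aN a(2) from_a[of i] above[of k] below[of i] parts
      by (auto simp: improves_def)
  qed
  obtain f where f: "f \<in> J - D" "(a, f) \<in> (arcs \<sigma> D)\<^sup>*"
    using first_undetermined[OF from_a[OF kJ] kJ] by blast
  have from_f: "reach f j" if "j \<in> J - D" for j
    using first_undetermined_reaches[OF f(2) from_a] that by blast
  have af: "reach a f" using from_a f by blast
  have fp: "f \<in> Jp - D"
    using max_after_k[of f] from_f[OF kJ] reach_antisym[of f k] f(1) k(1) parts by blast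
  obtain b where b: "b \<in> free_values" "v a < v b" "v b < v (\<sigma> f)"
    using second_least_below[OF a(1) f(2) fp] by blast
  then obtain j where j: "j \<in> J - D" "\<sigma> j = b" using used[of b] by auto
  have "j \<noteq> f" using j b by auto
  have fj: "reach f j" using from_f j by blast
  show False
  proof (cases "j \<in> Jp")
    case True
    then show False using no_rotation[of f j a] \<open>j \<noteq> f\<close> fj f j aN a(2) af b fp
      by (auto simp: improves_def)
  next
    case False
    then have jm: "j \<in> Jm - D" using j parts by blast
    then have kj: "reach k j" "j \<noteq> k" using max_after_k k parts by auto
    show False
    proof (cases "f = k")
      case False
      then show False
        using no_reversal[of f k j a] from_f[OF kJ] kj f kJ k j aN a(2) af b fp jm above[of k]
        by (auto simp: improves_def)
    next
      case True
      \<comment> \<open>Now \<open>f\<close> gains from any other free value, and every maximizing index gains from \<open>\<sigma> f = c\<close>.\<close>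
      then have fc: "\<sigma> f = c" using k by simp
      have reach_c: "reach c l" if "l \<in> J - D" "l \<noteq> f" for l
        using from_f[OF that(1)] reach_iff[of f l] f(1) fc that by auto
      obtain g where g: "g \<in> J - D" "(c, g) \<in> (arcs \<sigma> D)\<^sup>*"
        using first_undetermined[OF reach_c[OF j(1) \<open>j \<noteq> f\<close>] j(1)] by blast
      have from_g: "reach g l" if "l \<in> J - D" "l \<noteq> f" for l
        using first_undetermined_reaches[OF g(2) reach_c] that by blast
      have fg: "reach f g" "g \<noteq> f"
        using from_f[OF g(1)] reach_D[OF g(2)] no_return[of f] f(1) fc by auto
      show False
      proof (cases "g \<in> Jp")
        case True
        \<comment> \<open>Reversing the blocks that end in \<open>f\<close>, \<open>g\<close> and \<open>j\<close> gives them \<open>b\<close>, \<open>a\<close> and \<open>c\<close>.\<close>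
        then have "g \<noteq> j" using jm parts by blast
        then show False
          using no_reversal[of f g j a] fg from_g[OF j(1) \<open>j \<noteq> f\<close>] f g j aN a(2) af True fp jm
            above[OF g(1)] b
          by (auto simp: improves_def)
      next
        case False
        \<comment> \<open>The mirror image of the choice of \<open>b\<close>: the value \<open>d\<close> is better for \<open>g\<close>, and \<open>l\<close> has it.
           If \<open>l\<close> is minimizing, it takes \<open>a\<close> and \<open>g\<close> takes \<open>d\<close>. Otherwise \<open>f\<close>, \<open>g\<close> and \<open>l\<close> permute
           their values: \<open>l\<close> gets \<open>c\<close>, \<open>g\<close> gets \<open>d\<close> and \<open>f\<close> gets any value below \<open>c\<close>.\<close>
        then have gm: "g \<in> Jm - D" using g parts by blast
        obtain d where d: "d \<in> free_values" "v d < v c" "v (\<sigma> g) < v d"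
          using second_greatest_above[OF c(1) g(2) gm] by blast
        then have "d \<noteq> a" using above[OF g(1)] by auto
        then obtain l where l: "l \<in> J - D" "\<sigma> l = d" using used[OF d(1)] by blast
        have ne: "l \<noteq> f" "l \<noteq> g" using d l fc by auto
        have gl: "reach g l" using from_g l(1) ne(1) by blast
        show False
        proof (cases "l \<in> Jp")
          case True
          then show False
            using no_rotation[of g l a] gl ne l g gm d aN a(2) from_a[OF g(1)] above[OF l(1)]
            by (auto simp: improves_def)
        next
          case False
          then have "l \<in> Jm" using l parts by blast
          then show False
            using no_block_swap[of f g l] fg gl ne f g l fp gm d fc
            by (auto simp: improves_def)
        qed
      qed
    qed
  qed
qed

lemma greedy_never_stuck: False
proof -
  interpret flip: greedy_stuck N J Jm Jp "\<lambda>u. - v u" \<sigma> D by (rule flipped)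
  obtain j where "j \<in> J - D" using D_sub by blast
  then have ne: "free_values \<noteq> {}" using \<sigma>_free by blast
  obtain a where a: "least_free a" using exists_least_value[OF _ ne] by (auto simp: least_free_def)
  obtain c where c: "greatest_free c"
    using flip.exists_least_value[OF _ ne] by (auto simp: greatest_free_def)
  have fl: "flip.least_free c" "flip.greatest_free a"
    using a c by (auto simp: least_free_def greatest_free_def
        flip.least_free_def flip.greatest_free_def)
  show False
  proof (cases "a \<in> \<sigma> ` J")
    case True
    then show False
      using not_both_extremes_used[OF a _ c] flip.least_unused_greatest_used[OF fl(1) _ fl(2)] by blast
  next
    case False
    then have "c \<notin> \<sigma> ` J" using least_unused_greatest_used[OF a _ c] by blast
    then have "Jp \<subseteq> D" "Jm \<subseteq> D"
      using not_both_extremes_unused[OF a False c] flip.not_both_extremes_unused[OF fl(1) _ fl(2) False]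
      by blast+
    then show False using D_sub parts by blast
  qed
qed

end

text \<open>This supplies the next index of the ordering, once \<open>D\<close> has been processed.\<close>
lemma (in undominated_forest) greedy_choice_exists:
  assumes "D \<subset> J"
  shows "(\<exists>j\<in>Jp - D. \<forall>w\<in>N - \<sigma> ` D. (w, j) \<notin> (arcs \<sigma> D)\<^sup>* \<longrightarrow> v (\<sigma> j) \<le> v w) \<or>
    (\<exists>j\<in>Jm - D. \<forall>w\<in>N - \<sigma> ` D. (w, j) \<notin> (arcs \<sigma> D)\<^sup>* \<longrightarrow> v w \<le> v (\<sigma> j))"
proof (rule ccontr)
  assume "\<not> ?thesis"
  then have "greedy_stuck N J Jp Jm v \<sigma> D"
    by unfold_locales (use assms in \<open>force simp: not_le\<close>)+
  then show False by (rule greedy_stuck.greedy_never_stuck)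
qed

section \<open>Circuits as linear forests\<close>

text \<open>
  The lists in \<^const>\<open>creates_cycle\<close> have distinct entries, whereas closed walks may repeat nodes. A
  closed walk of least length under iteration of \<open>\<sigma>\<close> cannot repeat a node, because the part between
  two visits would be shorter.
\<close>
lemma cycle_iff_not_acyclic:
  assumes x: "\<And>j. j \<in> J \<Longrightarrow> x j = v (\<sigma> j)" and inj: "inj_on v N" "J \<subseteq> N" "\<sigma> ` J \<subseteq> N"
  shows "creates_cycle v J x \<longleftrightarrow> \<not> acyclic (arcs \<sigma> J)"
proof
  have step: "x i = v j \<longleftrightarrow> \<sigma> i = j" if "i \<in> J" "j \<in> J" for i j
    using that x[OF that(1)] inj unfolding inj_on_def by (metis image_subset_iff subsetD)
  {
    assume "creates_cycle v J x"
    then obtain p where p: "p \<noteq> []" "set p \<subseteq> J"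
        "\<And>t. Suc t < length p \<Longrightarrow> x (p ! t) = v (p ! Suc t)" "x (last p) = v (hd p)"
      unfolding creates_cycle_def by blast
    have inJ: "p ! t \<in> J" if "t < length p" for t using that p(2) by auto
    have walk: "(hd p, p ! t) \<in> (arcs \<sigma> J)\<^sup>*" if "t < length p" for t
      using that
    proof (induction t)
      case 0
      then show ?case using p(1) by (simp add: hd_conv_nth)
    next
      case (Suc t)
      then have "(p ! t, p ! Suc t) \<in> arcs \<sigma> J"
        using p(3)[of t] step inJ by (simp add: in_arcs_iff)
      then show ?case using Suc by (meson Suc_lessD rtrancl.rtrancl_into_rtrancl)
    qed
    have "(hd p, last p) \<in> (arcs \<sigma> J)\<^sup>*"
      using walk[of "length p - 1"] p(1) by (simp add: last_conv_nth)
    moreover have "(last p, hd p) \<in> arcs \<sigma> J"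
      using p step by (auto simp: in_arcs_iff subset_iff)
    ultimately show "\<not> acyclic (arcs \<sigma> J)"
      unfolding acyclic_def by (meson rtrancl_into_trancl1)
  next
    assume "\<not> acyclic (arcs \<sigma> J)"
    then obtain a where a: "(a, a) \<in> (arcs \<sigma> J)\<^sup>+" unfolding acyclic_def by blast
    define period where
      "period m b \<longleftrightarrow> 0 < m \<and> (\<sigma> ^^ m) b = b \<and> (\<forall>t<m. (\<sigma> ^^ t) b \<in> J)" for m b
    have walk: "\<exists>m>0. (\<sigma> ^^ m) a = b \<and> (\<forall>t<m. (\<sigma> ^^ t) a \<in> J)" if "(a, b) \<in> (arcs \<sigma> J)\<^sup>+" for b
      using that
    proof (induction rule: trancl_induct)
      case (base y)
      then show ?case by (intro exI[of _ 1]) (auto simp: in_arcs_iff)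
    next
      case (step y z)
      then obtain m where "m > 0" "(\<sigma> ^^ m) a = y" "\<forall>t<m. (\<sigma> ^^ t) a \<in> J" by blast
      then show ?case using step.hyps(2)
        by (intro exI[of _ "Suc m"]) (auto simp: in_arcs_iff less_Suc_eq)
    qed
    have "\<exists>m b. period m b" using walk[OF a] unfolding period_def by blast
    then obtain m b where mb: "period m b" and least: "\<And>m' b'. m' < m \<Longrightarrow> \<not> period m' b'"
      using exists_least_iff[of "\<lambda>m. \<exists>b. period m b"] by blast
    define p where "p = map (\<lambda>t. (\<sigma> ^^ t) b) [0..<m]"
    have ne: "(\<sigma> ^^ s) b \<noteq> (\<sigma> ^^ t) b" if "s < t" "t < m" for s t
    proof
      assume eq: "(\<sigma> ^^ s) b = (\<sigma> ^^ t) b"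
      have shift: "(\<sigma> ^^ r) ((\<sigma> ^^ s) b) = (\<sigma> ^^ (r + s)) b" for r by (simp add: funpow_add)
      have "period (t - s) ((\<sigma> ^^ s) b)"
        using that eq mb unfolding period_def shift by auto
      then show False using least[of "t - s"] that by auto
    qed
    have "distinct p"
      unfolding p_def distinct_map
      by (auto simp: inj_on_def) (metis ne nat_neq_iff)
    moreover have "p \<noteq> []" "set p \<subseteq> J" using mb by (auto simp: p_def period_def)
    moreover have "x (p ! t) = v (p ! Suc t)" if "Suc t < length p" for t
      using that mb x by (auto simp: p_def period_def)
    moreover have "x (last p) = v (hd p)"
    proof -
      have m: "m > 0" using mb by (simp add: period_def)
      have "last p = (\<sigma> ^^ (m - 1)) b" "hd p = b"
        using m by (auto simp: p_def last_map hd_map)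
      moreover have "\<sigma> ((\<sigma> ^^ (m - 1)) b) = b" "(\<sigma> ^^ (m - 1)) b \<in> J"
        using mb m unfolding period_def by (metis Suc_diff_1 comp_apply funpow.simps(2), simp)
      ultimately show ?thesis using x by simp
    qed
    ultimately show "creates_cycle v J x" unfolding creates_cycle_def by blast
  }
qed

lemma circuit_iff_linear_forest:
  assumes x: "\<And>j. j \<in> J \<Longrightarrow> x j = v (\<sigma> j)" and "x \<in> extensional J"
    and inj: "inj_on v {1..n}" "J \<subseteq> {1..n}" "\<sigma> ` J \<subseteq> {1..n}"
  shows "circuit v n J x \<longleftrightarrow> linear_forest {1..n} J \<sigma>"
proof -
  have "x \<in> J \<rightarrow>\<^sub>E v ` {1..n}" using assms by (auto simp: PiE_def)
  moreover have "inj_on x J \<longleftrightarrow> inj_on \<sigma> J"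
  proof -
    have "x i = x j \<longleftrightarrow> \<sigma> i = \<sigma> j" if "i \<in> J" "j \<in> J" for i j
      using that x inj(1,3) unfolding inj_on_def by (metis image_subset_iff)
    then show ?thesis by (auto simp: inj_on_def)
  qed
  ultimately show ?thesis
    unfolding circuit_def linear_forest_def using cycle_iff_not_acyclic[OF x inj] inj(3) by blast
qed

lemma circuit_restrict:
  assumes "circuit v n J x" "D \<subseteq> J"
  shows "circuit v n D (restrict x D)"
proof -
  have "creates_cycle v J x" if "creates_cycle v D (restrict x D)"
  proof -
    obtain p where p: "p \<noteq> []" "distinct p" "set p \<subseteq> D"
        "\<And>t. Suc t < length p \<Longrightarrow> restrict x D (p ! t) = v (p ! Suc t)"
        "restrict x D (last p) = v (hd p)"
      using \<open>creates_cycle v D (restrict x D)\<close> unfolding creates_cycle_def by blast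
    have "x i = restrict x D i" if "i \<in> set p" for i using that p(3) by auto
    then have "\<forall>t. Suc t < length p \<longrightarrow> x (p ! t) = v (p ! Suc t)" "x (last p) = v (hd p)"
      using p by auto
    then show ?thesis unfolding creates_cycle_def using p(1-3) assms(2) by blast
  qed
  then show ?thesis
    using assms unfolding circuit_def by (auto intro: inj_on_subset)
qed

section \<open>Undominated circuits are greedy\<close>
theorem theorem10:
  fixes v :: "nat \<Rightarrow> real" and n :: nat and J Jp Jm :: "nat set" and x :: "nat \<Rightarrow> real"
  assumes "0 \<le> v 1"
    and "strict_mono_on {1..n} v"
    and "J \<subseteq> {1..n}"
    and "Jp \<union> Jm = J"
    and "Jp \<inter> Jm = {}"
    and "circuit v n J x"
    and "undominated v n J Jp Jm x"
  shows "\<exists>js. distinct js \<and> set js = J \<and> greedy v n Jp Jm js x"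
proof -
  let ?N = "{1..n}"
  have inj: "inj_on v ?N" using assms(2) by (rule strict_mono_on_imp_inj_on)
  define \<sigma> where "\<sigma> j = inv_into ?N v (x j)" for j
  have xJ: "x j \<in> v ` ?N" if "j \<in> J" for j using assms(6) that by (auto simp: circuit_def)
  have x\<sigma>: "x j = v (\<sigma> j)" if "j \<in> J" for j
    unfolding \<sigma>_def using xJ[OF that] by (simp add: f_inv_into_f)
  have \<sigma>N: "\<sigma> ` J \<subseteq> ?N" unfolding \<sigma>_def using xJ by (metis image_subsetI inv_into_into)
  have ext: "x \<in> extensional J" using assms(6) by (auto simp: circuit_def PiE_def)
  interpret undominated_forest ?N J Jp Jm v \<sigma>
  proof unfold_locales
    show "linear_forest ?N J \<sigma>"
      using circuit_iff_linear_forest[OF x\<sigma> ext inj assms(3) \<sigma>N] assms(6) by blast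
    fix \<tau> assume \<tau>: "linear_forest ?N J \<tau>"
      "\<forall>j\<in>Jp. v (\<tau> j) \<le> v (\<sigma> j)" "\<forall>j\<in>Jm. v (\<sigma> j) \<le> v (\<tau> j)"
    then have \<tau>N: "\<tau> ` J \<subseteq> ?N" by (simp add: linear_forest_def)
    define y where "y = (\<lambda>j\<in>J. v (\<tau> j))"
    have "circuit v n J y"
      using circuit_iff_linear_forest[of J y v \<tau>, OF _ _ inj assms(3) \<tau>N] \<tau>(1)
      by (simp add: y_def)
    moreover have "dominates Jp Jm y x"
      using \<tau>(2,3) x\<sigma> assms(4) by (auto simp: dominates_def y_def)
    ultimately have "y = x" using assms(7) unfolding undominated_def by blast
    show "\<forall>j\<in>J. \<tau> j = \<sigma> j"
    proof
      fix j assume "j \<in> J"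
      then have "v (\<tau> j) = v (\<sigma> j)" using \<open>y = x\<close> x\<sigma> by (auto simp: y_def dest: fun_cong[of _ _ j])
      then show "\<tau> j = \<sigma> j"
        using inj \<open>j \<in> J\<close> \<tau>N \<sigma>N by (meson image_subset_iff inj_on_def)
    qed
  qed (use assms inj in auto)

  \<comment> \<open>The greedy candidates for \<open>j\<close> after \<open>D\<close> contain the value of \<open>x\<close>, and they obey the description
     of the admissible values in \<open>greedy_choice_exists\<close>. So a best admissible value is the \<open>Min\<close> or \<open>Max\<close>.\<close>
  have next_candidates:
    "finite (candidates v n D (restrict x D) j)"
    "x j \<in> candidates v n D (restrict x D) j"
    "\<forall>a\<in>candidates v n D (restrict x D) j.
       \<exists>w\<in>?N - \<sigma> ` D. a = v w \<and> (w, j) \<notin> (arcs \<sigma> D)\<^sup>*"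
    "(restrict x D)(j := x j) = restrict x (insert j D)"
    if D: "D \<subset> J" and j: "j \<in> J - D" for D j
  proof -
    show upd: "(restrict x D)(j := x j) = restrict x (insert j D)" by (auto simp: restrict_def)
    show "finite (candidates v n D (restrict x D) j)" by (simp add: candidates_def)
    have "circuit v n (insert j D) (restrict x (insert j D))"
      using circuit_restrict[OF assms(6), of "insert j D"] D j by blast
    moreover have "x j \<notin> restrict x D ` D"
      using assms(6) D j by (auto simp: circuit_def inj_on_def)
    ultimately show "x j \<in> candidates v n D (restrict x D) j"
      using xJ j by (auto simp: candidates_def upd)
    show "\<forall>a\<in>candidates v n D (restrict x D) j.
       \<exists>w\<in>?N - \<sigma> ` D. a = v w \<and> (w, j) \<notin> (arcs \<sigma> D)\<^sup>*"
    proof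
      fix a assume "a \<in> candidates v n D (restrict x D) j"
      then obtain w where w: "w \<in> ?N" "a = v w" "v w \<notin> restrict x D ` D"
          "circuit v n (insert j D) ((restrict x D)(j := v w))"
        by (auto simp: candidates_def)
      have "w \<notin> \<sigma> ` D"
      proof
        assume "w \<in> \<sigma> ` D"
        then obtain i where "i \<in> D" "w = \<sigma> i" by blast
        then have "v w = restrict x D i" using x\<sigma>[of i] D by auto
        then show False using w(3) \<open>i \<in> D\<close> by blast
      qed
      have "linear_forest ?N (insert j D) (\<sigma>(j := w))"
      proof (rule iffD1[OF circuit_iff_linear_forest w(4)])
        show "((restrict x D)(j := v w)) i = v ((\<sigma>(j := w)) i)" if "i \<in> insert j D" for i
          using that x\<sigma>[of i] D by auto
      qed (use inj assms(3) \<sigma>N w(1) D j in \<open>auto simp: extensional_def\<close>)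
      then have acyc: "acyclic (arcs (\<sigma>(j := w)) (insert j D))" by (simp add: linear_forest_def)
      have "arcs \<sigma> D \<subseteq> arcs (\<sigma>(j := w)) (insert j D)" using j by (auto simp: arcs_def)
      then have "(w, j) \<notin> (arcs \<sigma> D)\<^sup>*"
        using acyc rtrancl_mono unfolding acyclic_def
        by (metis fun_upd_same in_arcs_iff insertI1 rtrancl_into_trancl1 subsetD)
      then show "\<exists>w\<in>?N - \<sigma> ` D. a = v w \<and> (w, j) \<notin> (arcs \<sigma> D)\<^sup>*"
        using w \<open>w \<notin> \<sigma> ` D\<close> by blast
    qed
  qed

  have "\<exists>js. distinct js \<and> set js \<subseteq> J \<and> length js = m \<and> greedy v n Jp Jm js (restrict x (set js))"
    if "m \<le> card J" for m
    using that
  proof (induction m)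
    case 0
    show ?case using greedy_Nil[of v n Jp Jm] by (intro exI[of _ "[]"]) auto
  next
    case (Suc m)
    then obtain js where js: "distinct js" "set js \<subseteq> J" "length js = m"
      "greedy v n Jp Jm js (restrict x (set js))" using Suc_leD by blast
    then have D: "set js \<subset> J" using Suc.prems by (metis Suc_n_not_le_n distinct_card psubsetI)
    let ?C = "candidates v n (set js) (restrict x (set js))"
    consider (min) j where "j \<in> Jp - set js" "\<forall>w\<in>?N - \<sigma> ` set js.
          (w, j) \<notin> (arcs \<sigma> (set js))\<^sup>* \<longrightarrow> v (\<sigma> j) \<le> v w"
      | (max) j where "j \<in> Jm - set js" "\<forall>w\<in>?N - \<sigma> ` set js.
          (w, j) \<notin> (arcs \<sigma> (set js))\<^sup>* \<longrightarrow> v w \<le> v (\<sigma> j)"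
      using greedy_choice_exists[OF D] by blast
    then have "\<exists>j\<in>J - set js. greedy v n Jp Jm (js @ [j]) (restrict x (set (js @ [j])))"
    proof cases
      case min
      then have j: "j \<in> J - set js" using assms(4) by blast
      note C = next_candidates[OF D j]
      have "x j = Min (?C j)"
        by (rule Min_eqI[symmetric]) (use C min(2) x\<sigma>[of j] j in force)+
      then have "greedy v n Jp Jm (js @ [j]) ((restrict x (set js))(j := x j))"
        using greedy_min[OF js(4), of j] min(1) C(2) by auto
      then show ?thesis using j C(4) by auto
    next
      case max
      then have j: "j \<in> J - set js" using assms(4) by blast
      note C = next_candidates[OF D j]
      have "x j = Max (?C j)"
        by (rule Max_eqI[symmetric]) (use C max(2) x\<sigma>[of j] j in force)+
      then have "greedy v n Jp Jm (js @ [j]) ((restrict x (set js))(j := x j))"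
        using greedy_max[OF js(4), of j] max(1) C(2) by auto
      then show ?thesis using j C(4) by auto
    qed
    then obtain j where j: "j \<in> J - set js"
      "greedy v n Jp Jm (js @ [j]) (restrict x (set (js @ [j])))" by blast
    then have "distinct (js @ [j])" "set (js @ [j]) \<subseteq> J" "length (js @ [j]) = Suc m"
      using js by auto
    then show ?case using j(2) by blast
  qed
  then obtain js where js: "distinct js" "set js \<subseteq> J" "length js = card J"
    "greedy v n Jp Jm js (restrict x (set js))" by (metis order_refl)
  have "finite J" using assms(3) finite_subset by blast
  then have "set js = J" using js(1-3) by (metis card_subset_eq distinct_card)
  moreover have "restrict x J = x" using ext by (rule extensional_restrict)
  ultimately show ?thesis using js by auto
qed

end
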